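(* Let $\mathcal{B}$ denote the Boolean semiring. (1) Let $S=B_1 \times B_2 \times \cdots \times B_m \times Z_1 \times Z_2 \times \cdots \times Z_n$, where $m, n \geq 1$, $B_i=\mathcal{B}$ for $i=1,2,\ldots,m$, and for every $i=1,2,\ldots,n$, $Z_i$ is an antinegative finite commutative semiring with $Z(Z_i)$ closed under addition, $|Z_i| \geq 3$ and $|Z_i \setminus Z(Z_i)|=1$. Then $$\dim(\Gamma_1(S)) = |S|+m-2^{m+n}=|Z(S)|-2^{m+n}+m+1.$$ (2) Let $S=R \times B_1 \times B_2 \times \cdots \times B_m \times Z_1 \times Z_2 \times \cdots \times Z_n$, where $m, n \geq 0$ are not both zero, $R$ is an antinegative finite commutative semiring with $|R| \geq 3$ and $|Z(R)|=1$, $B_i=\mathcal{B}$ for $i=1,2,\ldots,m$, and for every $i=1,2,\ldots,n$, $Z_i$ is an antinegative finite commutative semiring with $Z(Z_i)$ closed under addition, $|Z_i| \geq 3$ and $|Z_i \setminus Z(Z_i)|=1$. Then $$\dim(\Gamma_1(S)) = |S|-2^{m+n+1}-|R|+3=|Z(S)|-2^{m+n+1}+2.$$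
   Context: A semiring is a set $S$ with binary operations $+$ and $\cdot$ such that $(S,+)$ is a commutative monoid with identity $0$, $(S,\cdot)$ is a monoid with identity $1$, multiplication distributes over addition on both sides, and $0\cdot x = x\cdot 0 = 0$ for all $x\in S$. It is commutative if $ab=ba$ for all $a,b\in S$, and antinegative if $a+b=0$ with $a,b\in S$ implies $a=b=0$. The Boolean semiring is $\mathcal{B}=\{0,1\}$ with $0\neq 1$ and $1+1=1$. Direct products of semirings have componentwise operations. The set of zero-divisors of a semiring $S$ is $Z(S)=\{x \in S : \text{there exists } 0 \neq y \in S \text{ such that } xy=0 \text{ or } yx=0\}$ (so $0\in Z(S)$ when $S\neq\{0\}$); in particular $Z(Z_i)$ denotes the set of zero-divisors of the semiring $Z_i$. $\Gamma_1(S)$ is the simple undirected graph with vertex set $Z(S)$ in which distinct $x,y\in Z(S)$ are adjacent if and only if $x+y\in Z(S)$ (it is the subgraph, induced on $Z(S)$, of the total graph of $S$). For a finite connected graph $G$, $d(u,v)$ denotes the length of a shortest path between $u$ and $v$. For an ordered subset $W=\{w_1,\ldots,w_k\}$ of the vertex set, the representation of a vertex $v$ with respect to $W$ is the vector $(d(v,w_1),\ldots,d(v,w_k))$. $W$ is a resolving set for $G$ if distinct vertices of $G$ have distinct representations with respect to $W$. The metric dimension $\dim(G)$ is the minimal cardinality of a resolving set for $G$. *)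

theory Defs
  imports
    "HOL-Algebra.Chinese_Remainder"
    "Graph_Theory.Pair_Digraph"
begin

section \<open>Semirings\<close>

locale comm_semiring = semiring R + comm_monoid R for R (structure)

definition antinegative :: "('a, 'b) ring_scheme \<Rightarrow> bool" where
  "antinegative S \<longleftrightarrow>
     (\<forall>a\<in>carrier S. \<forall>b\<in>carrier S. a \<oplus>\<^bsub>S\<^esub> b = \<zero>\<^bsub>S\<^esub> \<longrightarrow> a = \<zero>\<^bsub>S\<^esub> \<and> b = \<zero>\<^bsub>S\<^esub>)"

definition zero_divisors :: "('a, 'b) ring_scheme \<Rightarrow> 'a set" where
  "zero_divisors S =
     {x \<in> carrier S. \<exists>y\<in>carrier S. y \<noteq> \<zero>\<^bsub>S\<^esub> \<and>
        (x \<otimes>\<^bsub>S\<^esub> y = \<zero>\<^bsub>S\<^esub> \<or> y \<otimes>\<^bsub>S\<^esub> x = \<zero>\<^bsub>S\<^esub>)}"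

definition boolean_semiring :: "bool ring" where
  "boolean_semiring =
     \<lparr>carrier = UNIV, monoid.mult = (\<and>), one = True, zero = False, add = (\<or>)\<rparr>"

text \<open>
  The direct product of an indexed family; binary products are \<open>RDirProd\<close>. Over the empty
  index set this is the one-element semiring, which as a factor of \<open>RDirProd\<close> changes nothing up
  to isomorphism.
\<close>

definition product_semiring :: "'i set \<Rightarrow> ('i \<Rightarrow> ('a, 'b) ring_scheme) \<Rightarrow> ('i \<Rightarrow> 'a) ring" where
  "product_semiring I S =
     \<lparr>carrier = (\<Pi>\<^sub>E i\<in>I. carrier (S i)),
      monoid.mult = (\<lambda>x y. \<lambda>i\<in>I. x i \<otimes>\<^bsub>S i\<^esub> y i),
      one = (\<lambda>i\<in>I. \<one>\<^bsub>S i\<^esub>),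
      zero = (\<lambda>i\<in>I. \<zero>\<^bsub>S i\<^esub>),
      add = (\<lambda>x y. \<lambda>i\<in>I. x i \<oplus>\<^bsub>S i\<^esub> y i)\<rparr>"


section \<open>The graph on the zero-divisors\<close>

text \<open>
  A simple undirected graph is represented by the loop-free digraph that has both arcs
  \<open>(x, y)\<close> and \<open>(y, x)\<close> for every edge. The arc relation below is symmetric because addition is
  commutative.
\<close>

definition Gamma1 :: "('a, 'b) ring_scheme \<Rightarrow> 'a pair_pre_digraph" where
  "Gamma1 S =
     \<lparr>pverts = zero_divisors S,
      parcs = {(x, y). x \<in> zero_divisors S \<and> y \<in> zero_divisors S \<and> x \<noteq> y \<and>
                       x \<oplus>\<^bsub>S\<^esub> y \<in> zero_divisors S}\<rparr>"


section \<open>Metric dimension\<close>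

text \<open>
  The definitions in this section are meant for finite connected graphs: \<open>graph_dist\<close> is
  unspecified when there is no path from \<open>u\<close> to \<open>v\<close>. A path is a list of arcs, so \<open>length p\<close> counts
  edges.
\<close>

definition graph_dist :: "'v pair_pre_digraph \<Rightarrow> 'v \<Rightarrow> 'v \<Rightarrow> nat" where
  "graph_dist G u v = (LEAST k. \<exists>p. pre_digraph.apath (with_proj G) u p v \<and> length p = k)"

definition representation :: "'v pair_pre_digraph \<Rightarrow> 'v list \<Rightarrow> 'v \<Rightarrow> nat list" where
  "representation G ws v = map (\<lambda>w. graph_dist G v w) ws"

text \<open>An ordered subset of the vertices is a list of vertices without repetitions.\<close>

definition resolving_set :: "'v pair_pre_digraph \<Rightarrow> 'v list \<Rightarrow> bool" where
  "resolving_set G ws \<longleftrightarrow>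
     distinct ws \<and> set ws \<subseteq> pverts G \<and> inj_on (representation G ws) (pverts G)"

definition metric_dim :: "'v pair_pre_digraph \<Rightarrow> nat" where
  "metric_dim G = (LEAST k. \<exists>ws. resolving_set G ws \<and> length ws = k)"

end

theory Submission
  imports Defs
begin

text \<open>
  Attach to every element \<open>x\<close> of the product its \<^emph>\<open>locus\<close>, the set of those coordinates in which \<open>x\<close>
  has a zero-divisor. In a product, \<open>x\<close> is a zero-divisor iff its locus is nonempty. In each factor a
  sum is a zero-divisor iff both summands are, so the locus of \<open>x + y\<close> is the intersection of the
  two loci, and \<open>x\<close>, \<open>y\<close> are adjacent iff their loci meet. Hence \<open>\<Gamma>\<^sub>1\<close> is determined by how many
  vertices bear each nonempty set of coordinates as their locus. Distances are 0, 1 or 2, because \<open>0\<close>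
  is adjacent to everything.

  Two vertices with the same locus are twins, so a resolving set contains all but at most one vertex
  of each locus. Choosing a resolving set is therefore choosing the loci of which one vertex is left
  out; such a family is called \<^emph>\<open>omittable\<close> below, and the metric dimension is the number of vertices
  minus the size of a largest omittable family (\<open>metric_dim_eq\<close>). Omitting a locus that only one
  vertex bears (a \<^emph>\<open>lone\<close> locus) has a price: it then no longer helps to separate the other vertices.

  In part (1) the lone loci are those that consist of Boolean coordinates. Loci that contain all the
  coordinates of the \<open>Z\<^sub>i\<close> can only be separated by lone ones; there are \<open>2\<^sup>m\<close> of them, and \<open>s\<close> lone loci
  separate at most \<open>2\<^sup>s\<close>, which forces at least \<open>m\<close> nonempty sets to be missing from an omittable
  family (\<open>card_omittable_le\<close>). In part (2) the full locus and the locus of all coordinates except that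
  of \<open>R\<close> can only be separated by the lone locus formed by the coordinate of \<open>R\<close>, so at least one set
  is missing (\<open>card_omittable_less\<close>). Both bounds are attained by keeping the lone singletons, since
  singletons separate any two sets (\<open>omittable_if_singletons\<close>).
\<close>

section \<open>Graphs whose adjacency is decided by intersecting labels\<close>

definition nonempty_subsets :: "'i set \<Rightarrow> 'i set set" where
  "nonempty_subsets I = Pow I - {{}}"

text \<open>
  If \<open>Q\<close> is the set of labels borne by a single vertex, these are the families \<open>\<U>\<close> such that omitting one
  vertex for each label in \<open>\<U>\<close> leaves a resolving set: a label is still available to separate two
  omitted vertices unless its only bearer has been omitted.
\<close>

definition omittable :: "'i set \<Rightarrow> 'i set set \<Rightarrow> 'i set set \<Rightarrow> bool" where
  "omittable I Q \<U> \<longleftrightarrow> \<U> \<subseteq> nonempty_subsets I \<and>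
     (\<forall>A\<in>\<U>. \<forall>B\<in>\<U>. A \<noteq> B \<longrightarrow>
        (\<exists>C\<in>nonempty_subsets I - \<U> \<inter> Q. (A \<inter> C = {}) \<noteq> (B \<inter> C = {})))"

lemma omittableE:
  assumes "omittable I Q \<U>" and "A \<in> \<U>" and "B \<in> \<U>" and "A \<noteq> B"
  obtains C where "C \<in> nonempty_subsets I" and "C \<notin> \<U> \<inter> Q"
    and "(A \<inter> C = {}) \<noteq> (B \<inter> C = {})"
  using assms unfolding omittable_def by blast

locale intersection_graph =
  fixes G :: "'v pair_pre_digraph" and I :: "'i set" and lab :: "'v \<Rightarrow> 'i set"
  assumes finite_verts: "finite (pverts G)"
    and labels: "lab ` pverts G = nonempty_subsets I"
    and arc_iff: "\<And>x y. (x, y) \<in> parcs G \<longleftrightarrow>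
          x \<in> pverts G \<and> y \<in> pverts G \<and> x \<noteq> y \<and> lab x \<inter> lab y \<noteq> {}"
begin

definition lone :: "'i set set" where
  "lone = {A. is_singleton {v \<in> pverts G. lab v = A}}"

lemma graph_dist_eq:
  assumes u: "u \<in> pverts G" and v: "v \<in> pverts G"
  shows "graph_dist G u v = (if u = v then 0 else if lab u \<inter> lab v \<noteq> {} then 1 else 2)"
proof -
  define P where "P k \<longleftrightarrow> (\<exists>p. pre_digraph.apath (with_proj G) u p v \<and> length p = k)" for k
  note path = pre_digraph.apath_def pre_digraph.awalk_def pre_digraph.cas.simps
    pre_digraph.awalk_verts.simps
  have P0: "P 0 \<longleftrightarrow> u = v"
    using u by (auto simp: P_def path)
  have P1: "P 1 \<longleftrightarrow> u \<noteq> v \<and> lab u \<inter> lab v \<noteq> {}"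
  proof
    assume "P 1"
    then obtain e where "pre_digraph.apath (with_proj G) u [e] v"
      by (auto simp: P_def length_Suc_conv)
    then have "(u, v) \<in> parcs G" by (cases e) (auto simp: path)
    then show "u \<noteq> v \<and> lab u \<inter> lab v \<noteq> {}" using arc_iff by blast
  next
    assume "u \<noteq> v \<and> lab u \<inter> lab v \<noteq> {}"
    then have "pre_digraph.apath (with_proj G) u [(u, v)] v"
      using u v arc_iff by (auto simp: path)
    then show "P 1" unfolding P_def by (metis One_nat_def length_Cons list.size(3))
  qed
  have P2: "P 2" if "u \<noteq> v" "lab u \<inter> lab v = {}"
  proof -
    \<comment> \<open>A vertex carrying the full label is adjacent to all others.\<close>
    have nonempty: "lab u \<noteq> {}" "lab v \<noteq> {}" "lab u \<subseteq> I" "lab v \<subseteq> I"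
      using labels u v by (auto simp: nonempty_subsets_def)
    then have "I \<in> lab ` pverts G" by (auto simp: labels nonempty_subsets_def)
    then obtain z where z: "z \<in> pverts G" "lab z = I" by auto
    have "z \<noteq> u" "z \<noteq> v" using that nonempty z by auto
    moreover have "lab u \<inter> lab z \<noteq> {}" "lab z \<inter> lab v \<noteq> {}" using nonempty z by auto
    ultimately have "pre_digraph.apath (with_proj G) u [(u, z), (z, v)] v"
      using u v z that by (auto simp: path arc_iff)
    then show "P 2" unfolding P_def
      by (intro exI[of _ "[(u, z), (z, v)]"]) simp
  qed
  have dist: "graph_dist G u v = (LEAST k. P k)"
    by (simp add: graph_dist_def P_def)
  consider "u = v" | "u \<noteq> v" "lab u \<inter> lab v \<noteq> {}" | "u \<noteq> v" "lab u \<inter> lab v = {}"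
    by blast
  then show ?thesis
  proof cases
    case 1
    then have "(LEAST k. P k) = 0" using P0 by (intro Least_equality) auto
    then show ?thesis using 1 dist by simp
  next
    case 2
    have "(LEAST k. P k) = 1"
    proof (rule Least_equality)
      show "P 1" using P1 2 by simp
      show "1 \<le> k" if "P k" for k using that P0 2 by (cases k) auto
    qed
    then show ?thesis using 2 by (simp add: dist)
  next
    case 3
    have "(LEAST k. P k) = 2"
    proof (rule Least_equality)
      show "P 2" using P2 3 by simp
      show "2 \<le> k" if "P k" for k
      proof (rule ccontr)
        assume "\<not> 2 \<le> k"
        then have "k = 0 \<or> k = 1" by linarith
        then show False using that P0 P1 3 by auto
      qed
    qed
    then show ?thesis using 3 by (simp add: dist)
  qed
qed

text \<open>
  A vertex of \<open>ws\<close> is told apart from all others by its distance 0 to itself, so only pairs outside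
  \<open>ws\<close> matter. Their distances to \<open>ws\<close> are 1 or 2, according to whether the labels meet.
\<close>

lemma resolving_set_iff:
  "resolving_set G ws \<longleftrightarrow> distinct ws \<and> set ws \<subseteq> pverts G \<and>
     (\<forall>x\<in>pverts G - set ws. \<forall>y\<in>pverts G - set ws. x \<noteq> y \<longrightarrow>
        (\<exists>w\<in>set ws. (lab x \<inter> lab w = {}) \<noteq> (lab y \<inter> lab w = {})))"
proof (cases "set ws \<subseteq> pverts G")
  case sub: True
  have eq: "representation G ws x = representation G ws y \<longleftrightarrow>
        (\<forall>w\<in>set ws. graph_dist G x w = graph_dist G y w)" for x y
    by (simp add: representation_def)
  have outside: "graph_dist G x w \<noteq> graph_dist G y w \<longleftrightarrow>
        (lab x \<inter> lab w = {}) \<noteq> (lab y \<inter> lab w = {})"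
    if "x \<in> pverts G - set ws" "y \<in> pverts G - set ws" "w \<in> set ws" for x y w
    using that sub by (subst (1 2) graph_dist_eq) auto
  have inside: "graph_dist G x x \<noteq> graph_dist G y x"
    if "x \<in> set ws" "y \<in> pverts G" "x \<noteq> y" for x y
    using that sub by (subst (1 2) graph_dist_eq) auto
  have rep_eq: "representation G ws x = representation G ws y \<longleftrightarrow>
        (\<forall>w\<in>set ws. (lab x \<inter> lab w = {}) = (lab y \<inter> lab w = {}))"
    if "x \<in> pverts G - set ws" "y \<in> pverts G - set ws" for x y
    unfolding eq using outside[OF that] by blast
  have rep_neq: "representation G ws x \<noteq> representation G ws y"
    if "x \<in> pverts G" "y \<in> pverts G" "x \<noteq> y" "x \<in> set ws \<or> y \<in> set ws" for x y
    unfolding eq using inside[of x y] inside[of y x] that by metis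
  have "inj_on (representation G ws) (pverts G) \<longleftrightarrow>
     (\<forall>x\<in>pverts G - set ws. \<forall>y\<in>pverts G - set ws. x \<noteq> y \<longrightarrow>
        representation G ws x \<noteq> representation G ws y)"
    unfolding inj_on_def using rep_neq by (meson DiffD1 DiffI)
  then show ?thesis using sub by (simp add: resolving_set_def rep_eq)
qed (auto simp: resolving_set_def)

text \<open>
  The labels of the vertices outside a resolving set form an omittable family. No label repeats,
  since vertices with equal labels outside \<open>ws\<close> could not be separated.
\<close>

lemma omittable_of_resolving_set:
  assumes "resolving_set G ws"
  obtains \<U> where "omittable I lone \<U>" and "card (pverts G) = length ws + card \<U>"
proof
  define U where "U = pverts G - set ws"
  have sep: "\<exists>w\<in>set ws. (lab x \<inter> lab w = {}) \<noteq> (lab y \<inter> lab w = {})"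
    if "x \<in> U" "y \<in> U" "x \<noteq> y" for x y
    using assms that by (auto simp: resolving_set_iff U_def)
  have ws: "distinct ws" "set ws \<subseteq> pverts G"
    using assms by (auto simp: resolving_set_iff)
  have "inj_on lab U"
  proof (rule inj_onI, rule ccontr)
    fix x y assume "x \<in> U" "y \<in> U" "lab x = lab y" "x \<noteq> y"
    then show False using sep[of x y] by simp
  qed
  then have "card (lab ` U) = card U" by (rule card_image)
  moreover have "card (set ws) + card U = card (pverts G)"
    unfolding U_def using ws finite_verts
    by (metis add.commute card_Diff_subset card_mono finite_subset le_add_diff_inverse2)
  ultimately show "card (pverts G) = length ws + card (lab ` U)"
    using ws distinct_card by metis
  show "omittable I lone (lab ` U)"
    unfolding omittable_def
  proof (intro conjI ballI impI)
    show "lab ` U \<subseteq> nonempty_subsets I" using labels by (auto simp: U_def)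
  next
    fix A B assume "A \<in> lab ` U" "B \<in> lab ` U" "A \<noteq> B"
    then obtain x y where xy: "x \<in> U" "y \<in> U" "A = lab x" "B = lab y" "x \<noteq> y" by auto
    obtain w where w: "w \<in> set ws" "(A \<inter> lab w = {}) \<noteq> (B \<inter> lab w = {})"
      using sep[OF xy(1,2,5)] xy(3,4) by auto
    \<comment> \<open>If the label of \<open>w\<close> occurs in \<open>U\<close> too, then it is carried by two vertices.\<close>
    have "lab w \<notin> lab ` U \<inter> lone"
    proof
      assume "lab w \<in> lab ` U \<inter> lone"
      then obtain u where u: "u \<in> U" "lab u = lab w" and l: "lab w \<in> lone" by auto
      from l obtain z where "{v \<in> pverts G. lab v = lab w} = {z}"
        by (auto simp: lone_def is_singleton_def)
      then have "u = z" "w = z" using u w(1) ws by (auto simp: U_def)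
      then show False using u w(1) by (simp add: U_def)
    qed
    moreover have "lab w \<in> nonempty_subsets I" using labels w(1) ws by auto
    ultimately show "\<exists>C\<in>nonempty_subsets I - lab ` U \<inter> lone. (A \<inter> C = {}) \<noteq> (B \<inter> C = {})"
      using w(2) by blast
  qed
qed

text \<open>
  Leave out one vertex \<open>f A\<close> for each label \<open>A\<close> in \<open>\<U>\<close>. The remaining vertices still bear every label
  outside \<open>\<U> \<inter> lone\<close>: one outside \<open>\<U>\<close> loses no vertex, and one that is not lone has a second vertex.
\<close>

lemma resolving_set_of_omittable:
  assumes "omittable I lone \<U>"
  obtains ws where "resolving_set G ws" and "card (pverts G) = length ws + card \<U>"
proof -
  have sub: "\<U> \<subseteq> nonempty_subsets I" using assms by (simp add: omittable_def)
  have "\<exists>v. v \<in> pverts G \<and> lab v = A" if "A \<in> nonempty_subsets I" for A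
    using that unfolding labels[symmetric] by auto
  then obtain f where f: "\<And>A. A \<in> nonempty_subsets I \<Longrightarrow> f A \<in> pverts G \<and> lab (f A) = A"
    by metis
  have "inj_on f \<U>" using sub f by (metis inj_onI subsetD)
  then have card_U: "card (f ` \<U>) = card \<U>" by (rule card_image)
  have fU: "f ` \<U> \<subseteq> pverts G" using sub f by auto
  obtain ws where ws: "set ws = pverts G - f ` \<U>" "distinct ws"
    using finite_distinct_list finite_verts by (metis finite_Diff)
  have compl: "pverts G - set ws = f ` \<U>" using ws fU by auto
  have "resolving_set G ws"
    unfolding resolving_set_iff compl
  proof (intro conjI ballI impI)
    fix x y assume "x \<in> f ` \<U>" "y \<in> f ` \<U>" "x \<noteq> y"
    then obtain A B where AB: "A \<in> \<U>" "B \<in> \<U>" "x = f A" "y = f B" "A \<noteq> B" by auto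
    from omittableE[OF assms AB(1,2,5)]
    obtain C where C: "C \<in> nonempty_subsets I" "C \<notin> \<U> \<inter> lone"
      "(A \<inter> C = {}) \<noteq> (B \<inter> C = {})" .
    have "\<exists>w\<in>set ws. lab w = C"
    proof (cases "C \<in> \<U>")
      case False
      have "f C \<notin> f ` \<U>"
      proof
        assume "f C \<in> f ` \<U>"
        then obtain D where "D \<in> \<U>" "f C = f D" by auto
        then have "C = D" using f C(1) sub by (metis subsetD)
        then show False using \<open>D \<in> \<U>\<close> False by simp
      qed
      then show ?thesis using f[OF C(1)] ws by auto
    next
      case True
      then have "\<not> is_singleton {v \<in> pverts G. lab v = C}"
        using C(2) by (simp add: lone_def)
      then have "{v \<in> pverts G. lab v = C} \<noteq> {f C}"
        by (metis is_singletonI)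
      then obtain v where v: "v \<in> pverts G" "lab v = C" "v \<noteq> f C"
        using f[OF C(1)] by blast
      have "v \<notin> f ` \<U>"
      proof
        assume "v \<in> f ` \<U>"
        then obtain D where "D \<in> \<U>" "v = f D" by auto
        then show False using v f sub by (metis subsetD)
      qed
      then show ?thesis using v ws by auto
    qed
    then obtain w where "w \<in> set ws" "lab w = C" by auto
    then show "\<exists>w\<in>set ws. (lab x \<inter> lab w = {}) \<noteq> (lab y \<inter> lab w = {})"
      using C(3) AB f sub by (metis subsetD)
  qed (use ws in auto)
  moreover have "card (pverts G) = length ws + card \<U>"
  proof -
    have "card (pverts G) = card (set ws) + card (f ` \<U>)"
      using fU finite_verts unfolding ws(1)
      by (metis card_Diff_subset card_mono finite_subset le_add_diff_inverse2)
    then show ?thesis using card_U ws(2) by (simp add: distinct_card)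
  qed
  ultimately show ?thesis using that by blast
qed

text \<open>
  Together, the two constructions exchange resolving sets and omittable families, with
  complementary sizes.
\<close>

lemma metric_dim_eq:
  assumes \<U>: "omittable I lone \<U>"
    and max: "\<And>\<V>. omittable I lone \<V> \<Longrightarrow> card \<V> \<le> card \<U>"
  shows "card (pverts G) = metric_dim G + card \<U>"
proof -
  obtain ws where ws: "resolving_set G ws" "card (pverts G) = length ws + card \<U>"
    using resolving_set_of_omittable[OF \<U>] .
  have "metric_dim G = length ws"
    unfolding metric_dim_def
  proof (rule Least_equality)
    show "\<exists>vs. resolving_set G vs \<and> length vs = length ws" using ws by blast
  next
    fix k assume "\<exists>vs. resolving_set G vs \<and> length vs = k"
    then obtain vs where vs: "resolving_set G vs" "length vs = k" by blast
    obtain \<V> where "omittable I lone \<V>" "card (pverts G) = length vs + card \<V>"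
      using omittable_of_resolving_set[OF vs(1)] .
    then show "length ws \<le> k" using max[of \<V>] ws vs by linarith
  qed
  then show ?thesis using ws by simp
qed

end


section \<open>The largest omittable families\<close>

lemma card_nonempty_subsets:
  assumes "finite I"
  shows "card (nonempty_subsets I) = 2 ^ card I - 1"
  using assms by (simp add: nonempty_subsets_def card_Pow card_Diff_subset)

lemma finite_nonempty_subsets: "finite I \<Longrightarrow> finite (nonempty_subsets I)"
  by (simp add: nonempty_subsets_def)

lemma omittable_if_singletons:
  assumes "\<U> \<subseteq> nonempty_subsets I"
    and "\<And>i. i \<in> I \<Longrightarrow> {i} \<notin> \<U> \<inter> Q"
  shows "omittable I Q \<U>"
  unfolding omittable_def
proof (intro conjI ballI impI)
  fix A B assume AB: "A \<in> \<U>" "B \<in> \<U>" "A \<noteq> B"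
  then obtain i where i: "i \<in> A \<and> i \<notin> B \<or> i \<in> B \<and> i \<notin> A" by blast
  then have "i \<in> I" using AB assms(1) by (auto simp: nonempty_subsets_def)
  then have "{i} \<in> nonempty_subsets I - \<U> \<inter> Q"
    using assms(2) by (auto simp: nonempty_subsets_def)
  then show "\<exists>C\<in>nonempty_subsets I - \<U> \<inter> Q. (A \<inter> C = {}) \<noteq> (B \<inter> C = {})"
    using i by (intro bexI[of _ "{i}"]) auto
qed (use assms(1) in auto)

text \<open>
  The extremal example for both parts of the theorem, where \<open>P\<close> consists of the coordinates whose
  singleton is a lone locus.
\<close>

lemma omittable_without_rare_singletons:
  assumes "finite I" "P \<subseteq> I" and "\<And>i. i \<in> I - P \<Longrightarrow> {i} \<notin> Q"
  defines "\<U> \<equiv> nonempty_subsets I - (\<lambda>i. {i}) ` P"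
  shows "omittable I Q \<U>" and "card \<U> + card P = 2 ^ card I - 1"
proof -
  show "omittable I Q \<U>"
    using assms(3) unfolding \<U>_def by (intro omittable_if_singletons) auto
  have "(\<lambda>i. {i}) ` P \<subseteq> nonempty_subsets I" using assms(2) by (auto simp: nonempty_subsets_def)
  then have "card (nonempty_subsets I) = card \<U> + card ((\<lambda>i. {i}) ` P)"
    unfolding \<U>_def using assms(1)
    by (metis card_Diff_subset card_mono finite_nonempty_subsets finite_subset le_add_diff_inverse2)
  then show "card \<U> + card P = 2 ^ card I - 1"
    using assms(1) by (simp add: card_nonempty_subsets card_image)
qed

lemma power_two_gap:
  assumes "s \<le> (m :: nat)"
  shows "2 ^ s + (m - s) \<le> (2 :: nat) ^ m"
proof -
  have "1 + d \<le> (2 :: nat) ^ d" for d by (induction d) auto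
  then have "2 ^ s * (1 + (m - s)) \<le> 2 ^ s * (2 :: nat) ^ (m - s)" by (intro mult_left_mono) simp_all
  moreover have "2 ^ s * (2 :: nat) ^ (m - s) = 2 ^ m"
    using assms by (simp add: power_add[symmetric])
  moreover have "m - s \<le> 2 ^ s * (m - s)" by simp
  ultimately show ?thesis by (simp add: algebra_simps)
qed

text \<open>
  Let \<open>s\<close> be the number of nonempty subsets of \<open>P\<close> missing from \<open>\<U>\<close>, and \<open>r\<close> the number of sets
  containing \<open>N\<close> that are missing. The sets in \<open>\<U>\<close> that contain \<open>N\<close> are separated by the \<open>s\<close> former sets
  only, so \<open>2 ^ card P - r \<le> 2 ^ s\<close>, which implies \<open>r + s \<ge> card P\<close>.
\<close>

lemma card_omittable_le:
  assumes fin: "finite I" and I: "I = P \<union> N" "P \<inter> N = {}" "N \<noteq> {}"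
    and rare: "nonempty_subsets P \<subseteq> Q"
    and \<U>: "omittable I Q \<U>"
  shows "card \<U> + card P \<le> 2 ^ card I - 1"
proof -
  define \<C> where "\<C> = nonempty_subsets P - \<U>"
  define \<F> where "\<F> = (\<lambda>A. N \<union> A) ` Pow P"
  have fP: "finite P" using fin I by simp
  have finC: "finite \<C>" using fP by (simp add: \<C>_def finite_nonempty_subsets)
  have finF: "finite \<F>" using fP by (simp add: \<F>_def)
  have "inj_on (\<lambda>A. N \<union> A) (Pow P)" using I by (auto simp: inj_on_def)
  then have cardF: "card \<F> = 2 ^ card P" using fP by (simp add: \<F>_def card_image card_Pow)
  have sub: "\<U> \<subseteq> nonempty_subsets I" using \<U> by (simp add: omittable_def)
  \<comment> \<open>Two labels containing \<open>N\<close> can only be told apart by labels disjoint from \<open>N\<close>, which are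
     all in \<open>Q\<close>.\<close>
  have "inj_on (\<lambda>A. {C \<in> \<C>. A \<inter> C = {}}) (\<F> \<inter> \<U>)"
  proof (rule inj_onI, rule ccontr)
    fix A B assume AB: "A \<in> \<F> \<inter> \<U>" "B \<in> \<F> \<inter> \<U>" "A \<noteq> B"
      and same: "{C \<in> \<C>. A \<inter> C = {}} = {C \<in> \<C>. B \<inter> C = {}}"
    have "A \<in> \<U>" "B \<in> \<U>" using AB by auto
    from omittableE[OF \<U> this AB(3)]
    obtain C where C: "C \<in> nonempty_subsets I" "C \<notin> \<U> \<inter> Q"
      "(A \<inter> C = {}) \<noteq> (B \<inter> C = {})" .
    have "N \<subseteq> A" "N \<subseteq> B" using AB by (auto simp: \<F>_def)
    then have "C \<inter> N = {}" using C(3) by auto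
    then have "C \<in> nonempty_subsets P" using C(1) I by (auto simp: nonempty_subsets_def)
    then have "C \<in> \<C>" using C(2) rare by (auto simp: \<C>_def)
    then show False using same C(3) by auto
  qed
  then have "card (\<F> \<inter> \<U>) \<le> card (Pow \<C>)"
    using finC by (intro card_inj_on_le) auto
  then have seen: "card (\<F> \<inter> \<U>) \<le> 2 ^ card \<C>" by (simp add: card_Pow finC)
  have split: "card \<F> = card (\<F> - \<U>) + card (\<F> \<inter> \<U>)"
    using finF by (metis card_Diff_subset_Int card_mono finite_Int inf_le1 le_add_diff_inverse2)
  have "card \<U> + card \<C> + card (\<F> - \<U>) = card (\<U> \<union> \<C> \<union> (\<F> - \<U>))"
  proof -
    have "finite \<U>" using sub fin finite_nonempty_subsets finite_subset by blast
    moreover have "\<C> \<inter> \<F> = {}" using I by (auto simp: \<C>_def \<F>_def nonempty_subsets_def)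
    ultimately show ?thesis using finC finF
      by (subst card_Un_disjoint; (subst card_Un_disjoint)?) (auto simp: \<C>_def)
  qed
  also have "\<dots> \<le> card (nonempty_subsets I)"
    using sub I fin
    by (intro card_mono) (auto simp: \<C>_def \<F>_def nonempty_subsets_def)
  finally have total: "card \<U> + card \<C> + card (\<F> - \<U>) \<le> 2 ^ card I - 1"
    using fin by (simp add: card_nonempty_subsets)
  have "card P \<le> card \<C> + card (\<F> - \<U>)"
  proof (cases "card \<C> \<le> card P")
    case True
    then show ?thesis using power_two_gap[OF True] seen split cardF by linarith
  qed simp
  then show ?thesis using total by linarith
qed

text \<open>
  Only \<open>{r}\<close> separates \<open>I\<close> from \<open>I - {r}\<close>, so \<open>\<U>\<close> cannot contain all three of them.
\<close>

lemma card_omittable_less: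
  assumes fin: "finite I" and r: "r \<in> I" "I \<noteq> {r}" "{r} \<in> Q"
    and \<U>: "omittable I Q \<U>"
  shows "card \<U> + 1 \<le> 2 ^ card I - 1"
proof -
  have sub: "\<U> \<subseteq> nonempty_subsets I" using \<U> by (simp add: omittable_def)
  have "\<U> \<noteq> nonempty_subsets I"
  proof
    assume all: "\<U> = nonempty_subsets I"
    have "I \<in> \<U>" "I - {r} \<in> \<U>" "I \<noteq> I - {r}"
      using r by (auto simp: all nonempty_subsets_def)
    from omittableE[OF \<U> this] obtain C where C: "C \<in> nonempty_subsets I" "C \<notin> \<U> \<inter> Q"
        "(I \<inter> C = {}) \<noteq> ((I - {r}) \<inter> C = {})" .
    have "C \<subseteq> I" "C \<noteq> {}" using C(1) by (simp_all add: nonempty_subsets_def)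
    then have "(I - {r}) \<inter> C = {}" using C(3) by auto
    then have "C = {r}" using \<open>C \<subseteq> I\<close> \<open>C \<noteq> {}\<close> by auto
    then show False using C all r by auto
  qed
  then have "card \<U> < card (nonempty_subsets I)"
    using sub fin finite_nonempty_subsets by (intro psubset_card_mono) auto
  then show ?thesis using fin by (simp add: card_nonempty_subsets)
qed


section \<open>The coordinates in which an element is a zero-divisor\<close>

text \<open>
  The interface through which \<open>\<Gamma>\<^sub>1\<close> sees a semiring. It is inherited by products, where the
  loci are collected side by side. The laws of zero serve to pad a zero-divisor of one factor with
  zeros in the others.
\<close>

locale zd_locus =
  fixes S :: "('a, 'b) ring_scheme" (structure) and I :: "'i set" and locus :: "'a \<Rightarrow> 'i set"
  assumes zero_closed: "\<zero> \<in> carrier S"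
    and add_closed: "\<And>x y. x \<in> carrier S \<Longrightarrow> y \<in> carrier S \<Longrightarrow> x \<oplus> y \<in> carrier S"
    and l_null: "\<And>x. x \<in> carrier S \<Longrightarrow> \<zero> \<otimes> x = \<zero>"
    and r_null: "\<And>x. x \<in> carrier S \<Longrightarrow> x \<otimes> \<zero> = \<zero>"
    and locus_subset: "\<And>x. x \<in> carrier S \<Longrightarrow> locus x \<subseteq> I"
    and locus_add: "\<And>x y. x \<in> carrier S \<Longrightarrow> y \<in> carrier S \<Longrightarrow> locus (x \<oplus> y) = locus x \<inter> locus y"
    and zero_divisor_iff: "\<And>x. x \<in> carrier S \<Longrightarrow> x \<in> zero_divisors S \<longleftrightarrow> locus x \<noteq> {}"

definition locus_class :: "('a, 'b) ring_scheme \<Rightarrow> ('a \<Rightarrow> 'i set) \<Rightarrow> 'i set \<Rightarrow> 'a set" where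
  "locus_class S locus A = {x \<in> carrier S. locus x = A}"

lemma zero_divisors_subset: "zero_divisors S \<subseteq> carrier S"
  by (auto simp: zero_divisors_def)

lemma (in zd_locus) zero_divisors_eq: "zero_divisors S = {x \<in> carrier S. locus x \<noteq> {}}"
  using zero_divisor_iff zero_divisors_subset[of S] by auto

lemma intersection_graph_Gamma1:
  assumes "zd_locus S I locus" and "finite (carrier S)"
    and inhabited: "\<And>A. A \<subseteq> I \<Longrightarrow> locus_class S locus A \<noteq> {}"
  shows "intersection_graph (Gamma1 S) I locus"
proof -
  interpret zd_locus S I locus by (rule assms(1))
  show ?thesis
  proof
    show "finite (pverts (Gamma1 S))"
      using assms(2) by (simp add: Gamma1_def zero_divisors_eq)
    show "locus ` pverts (Gamma1 S) = nonempty_subsets I"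
    proof (intro equalityI subsetI)
      fix A assume "A \<in> locus ` pverts (Gamma1 S)"
      then show "A \<in> nonempty_subsets I"
        using locus_subset by (auto simp: Gamma1_def nonempty_subsets_def zero_divisors_eq)
    next
      fix A assume A: "A \<in> nonempty_subsets I"
      then obtain x where "x \<in> locus_class S locus A"
        using inhabited[of A] by (auto simp: nonempty_subsets_def)
      then show "A \<in> locus ` pverts (Gamma1 S)"
        using A by (auto simp: Gamma1_def nonempty_subsets_def locus_class_def zero_divisors_eq)
    qed
    show "(x, y) \<in> parcs (Gamma1 S) \<longleftrightarrow>
        x \<in> pverts (Gamma1 S) \<and> y \<in> pverts (Gamma1 S) \<and> x \<noteq> y \<and> locus x \<inter> locus y \<noteq> {}" for x y
      using add_closed[of x y] locus_add[of x y] by (auto simp: Gamma1_def zero_divisors_eq)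
  qed
qed

lemma metric_dim_Gamma1:
  assumes S: "zd_locus S I locus" and "finite (carrier S)"
    and inhabited: "\<And>A. A \<subseteq> I \<Longrightarrow> locus_class S locus A \<noteq> {}"
  defines "Q \<equiv> {A. card (locus_class S locus A) = 1}"
  assumes \<U>: "omittable I Q \<U>"
    and max: "\<And>\<V>. omittable I Q \<V> \<Longrightarrow> card \<V> \<le> card \<U>"
  shows "card (zero_divisors S) = metric_dim (Gamma1 S) + card \<U>"
proof -
  interpret zd_locus S I locus by (rule assms(1))
  interpret intersection_graph "Gamma1 S" I locus
    using assms by (intro intersection_graph_Gamma1)
  have "{v \<in> pverts (Gamma1 S). locus v = A} = locus_class S locus A" if "A \<noteq> {}" for A
    using that by (auto simp: locus_class_def Gamma1_def zero_divisors_eq)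
  then have "A \<in> lone \<longleftrightarrow> A \<in> Q" if "A \<noteq> {}" for A
    using that by (simp add: lone_def Q_def is_singleton_altdef)
  then have "\<V> \<inter> lone = \<V> \<inter> Q" if "\<V> \<subseteq> nonempty_subsets I" for \<V>
    using that unfolding nonempty_subsets_def by blast
  then have "omittable I lone \<V> \<longleftrightarrow> omittable I Q \<V>" for \<V>
    unfolding omittable_def by metis
  then show ?thesis using metric_dim_eq \<U> max by (simp add: Gamma1_def)
qed

lemma card_carrier_eq:
  assumes "zd_locus S I locus" and "finite (carrier S)"
  shows "card (carrier S) = card (zero_divisors S) + card (locus_class S locus {})"
proof -
  interpret zd_locus S I locus by (rule assms(1))
  have "carrier S = zero_divisors S \<union> locus_class S locus {}"
    "zero_divisors S \<inter> locus_class S locus {} = {}"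
    by (auto simp: locus_class_def zero_divisors_eq)
  then show ?thesis using assms(2) by (metis card_Un_disjoint finite_Un)
qed

lemma (in semiring) zero_is_zero_divisor:
  assumes "carrier R \<noteq> {\<zero>}"
  shows "\<zero> \<in> zero_divisors R"
proof -
  obtain y where "y \<in> carrier R" "y \<noteq> \<zero>" using assms zero_closed by blast
  then show ?thesis by (auto simp: zero_divisors_def)
qed

text \<open>
  What the three kinds of factors have in common; it makes the locus of a sum an intersection.
\<close>

locale additive_zd_semiring = semiring +
  assumes add_zero_divisor_iff: "\<And>x y. x \<in> carrier R \<Longrightarrow> y \<in> carrier R \<Longrightarrow>
      x \<oplus> y \<in> zero_divisors R \<longleftrightarrow> x \<in> zero_divisors R \<and> y \<in> zero_divisors R"

text \<open>
  If \<open>(x + y) z = 0\<close> then \<open>x z + y z = 0\<close>, and antinegativity makes both terms vanish. So a summand of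
  a zero-divisor is always a zero-divisor.
\<close>

lemma additive_zd_semiringI:
  fixes A :: "('a, 'b) ring_scheme" (structure)
  assumes "semiring A" and "antinegative A"
    and closed: "\<And>x y. x \<in> zero_divisors A \<Longrightarrow> y \<in> zero_divisors A \<Longrightarrow> x \<oplus> y \<in> zero_divisors A"
  shows "additive_zd_semiring A"
proof -
  interpret semiring A by fact
  show ?thesis
  proof
    fix x y assume xy: "x \<in> carrier A" "y \<in> carrier A"
    have "x \<in> zero_divisors A \<and> y \<in> zero_divisors A" if xyz: "x \<oplus> y \<in> zero_divisors A"
    proof -
      obtain z where z: "z \<in> carrier A" "z \<noteq> \<zero>" "(x \<oplus> y) \<otimes> z = \<zero> \<or> z \<otimes> (x \<oplus> y) = \<zero>"
        using xyz by (auto simp: zero_divisors_def)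
      then have "x \<otimes> z \<oplus> y \<otimes> z = \<zero> \<or> z \<otimes> x \<oplus> z \<otimes> y = \<zero>"
        using xy by (simp add: l_distr r_distr)
      then have "x \<otimes> z = \<zero> \<and> y \<otimes> z = \<zero> \<or> z \<otimes> x = \<zero> \<and> z \<otimes> y = \<zero>"
        using xy z(1) assms(2) by (meson antinegative_def m_closed)
      then show ?thesis using xy z by (auto simp: zero_divisors_def)
    qed
    then show "x \<oplus> y \<in> zero_divisors A \<longleftrightarrow> x \<in> zero_divisors A \<and> y \<in> zero_divisors A"
      using closed by blast
  qed
qed

lemma carrier_boolean: "carrier boolean_semiring = {False, True}"
  by (auto simp: boolean_semiring_def)

lemma zero_divisors_boolean: "zero_divisors boolean_semiring = {False}"
  by (auto simp: zero_divisors_def boolean_semiring_def)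

lemma additive_zd_boolean: "additive_zd_semiring boolean_semiring"
proof (rule additive_zd_semiringI)
  show "semiring boolean_semiring"
    by unfold_locales (auto simp: boolean_semiring_def)
qed (auto simp: zero_divisors_def antinegative_def boolean_semiring_def)

text \<open>
  The locus in a single factor, with \<open>()\<close> as the only coordinate.
\<close>

definition factor_locus :: "('a, 'b) ring_scheme \<Rightarrow> 'a \<Rightarrow> unit set" where
  "factor_locus A x = (if x \<in> zero_divisors A then {()} else {})"

lemma zd_locus_factor:
  assumes "additive_zd_semiring A"
  shows "zd_locus A {()} (factor_locus A)"
proof -
  interpret additive_zd_semiring A by fact
  show ?thesis
    by unfold_locales (auto simp: factor_locus_def add_zero_divisor_iff)
qed

lemma locus_class_factor:
  "locus_class A (factor_locus A) {()} = zero_divisors A"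
  "locus_class A (factor_locus A) {} = carrier A - zero_divisors A"
  using zero_divisors_subset[of A] by (auto simp: locus_class_def factor_locus_def)

definition family_locus :: "'i set \<Rightarrow> ('i \<Rightarrow> ('a, 'b) ring_scheme) \<Rightarrow> ('i \<Rightarrow> 'a) \<Rightarrow> 'i set" where
  "family_locus J S x = {i \<in> J. x i \<in> zero_divisors (S i)}"

lemma zd_locus_product:
  assumes factor: "\<And>i. i \<in> J \<Longrightarrow> additive_zd_semiring (S i)"
  shows "zd_locus (product_semiring J S) J (family_locus J S)"
proof -
  let ?P = "product_semiring J S"
  note simps = product_semiring_def family_locus_def
  have semi: "semiring (S i)" if "i \<in> J" for i
    using factor[OF that] by (simp add: additive_zd_semiring_def)
  note in_factor = additive_zd_semiring.add_zero_divisor_iff[OF factor]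
    semiring.l_null[OF semi] semiring.r_null[OF semi]
  have zero_mem: "\<zero>\<^bsub>S i\<^esub> \<in> carrier (S i)" if "i \<in> J" for i
  proof -
    interpret semiring "S i" using semi that .
    show ?thesis by simp
  qed
  have add_mem: "x \<oplus>\<^bsub>S i\<^esub> y \<in> carrier (S i)"
    if "i \<in> J" "x \<in> carrier (S i)" "y \<in> carrier (S i)" for i x y
  proof -
    interpret semiring "S i" using semi that(1) .
    show ?thesis using that by simp
  qed
  show ?thesis
  proof
    show "\<zero>\<^bsub>?P\<^esub> \<in> carrier ?P" by (auto simp: simps zero_mem)
    fix x assume x: "x \<in> carrier ?P"
    then have xi: "x i \<in> carrier (S i)" if "i \<in> J" for i using that by (auto simp: simps)
    show "\<zero>\<^bsub>?P\<^esub> \<otimes>\<^bsub>?P\<^esub> x = \<zero>\<^bsub>?P\<^esub>" "x \<otimes>\<^bsub>?P\<^esub> \<zero>\<^bsub>?P\<^esub> = \<zero>\<^bsub>?P\<^esub>"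
      using xi by (auto simp: simps in_factor fun_eq_iff restrict_def)
    show "family_locus J S x \<subseteq> J" by (auto simp: simps)
    show "x \<in> zero_divisors ?P \<longleftrightarrow> family_locus J S x \<noteq> {}"
    proof
      assume "x \<in> zero_divisors ?P"
      then obtain y where y: "y \<in> carrier ?P" "y \<noteq> \<zero>\<^bsub>?P\<^esub>"
        "x \<otimes>\<^bsub>?P\<^esub> y = \<zero>\<^bsub>?P\<^esub> \<or> y \<otimes>\<^bsub>?P\<^esub> x = \<zero>\<^bsub>?P\<^esub>"
        by (auto simp: zero_divisors_def)
      have "\<exists>i\<in>J. y i \<noteq> \<zero>\<^bsub>S i\<^esub>"
      proof (rule ccontr)
        assume "\<not> ?thesis"
        then have "y = \<zero>\<^bsub>?P\<^esub>"
          using y(1) by (auto simp: simps fun_eq_iff PiE_def extensional_def)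
        then show False using y(2) by simp
      qed
      then obtain i where i: "i \<in> J" "y i \<noteq> \<zero>\<^bsub>S i\<^esub>" by blast
      have "x i \<otimes>\<^bsub>S i\<^esub> y i = \<zero>\<^bsub>S i\<^esub> \<or> y i \<otimes>\<^bsub>S i\<^esub> x i = \<zero>\<^bsub>S i\<^esub>"
        using y(3) i(1) by (auto simp: simps restrict_def fun_eq_iff split: if_splits)
      moreover have "y i \<in> carrier (S i)" using y(1) i(1) by (auto simp: simps)
      ultimately have "x i \<in> zero_divisors (S i)"
        using xi[OF i(1)] i(2) unfolding zero_divisors_def by blast
      then show "family_locus J S x \<noteq> {}" using i(1) by (auto simp: simps)
    next
      assume "family_locus J S x \<noteq> {}"
      then obtain i where i: "i \<in> J" "x i \<in> zero_divisors (S i)" by (auto simp: simps)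
      then obtain c where c: "c \<in> carrier (S i)" "c \<noteq> \<zero>\<^bsub>S i\<^esub>"
        "x i \<otimes>\<^bsub>S i\<^esub> c = \<zero>\<^bsub>S i\<^esub> \<or> c \<otimes>\<^bsub>S i\<^esub> x i = \<zero>\<^bsub>S i\<^esub>"
        by (auto simp: zero_divisors_def)
      define y where "y = (\<lambda>j\<in>J. if j = i then c else \<zero>\<^bsub>S j\<^esub>)"
      have "y \<in> carrier ?P" using c(1) by (auto simp: y_def simps zero_mem)
      moreover have "y \<noteq> \<zero>\<^bsub>?P\<^esub>"
      proof
        assume "y = \<zero>\<^bsub>?P\<^esub>"
        then have "y i = \<zero>\<^bsub>?P\<^esub> i" by simp
        then show False using c(2) i(1) by (simp add: y_def simps)
      qed
      moreover have "x \<otimes>\<^bsub>?P\<^esub> y = \<zero>\<^bsub>?P\<^esub> \<or> y \<otimes>\<^bsub>?P\<^esub> x = \<zero>\<^bsub>?P\<^esub>"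
        using c(3)
      proof
        assume "x i \<otimes>\<^bsub>S i\<^esub> c = \<zero>\<^bsub>S i\<^esub>"
        then have "x \<otimes>\<^bsub>?P\<^esub> y = \<zero>\<^bsub>?P\<^esub>"
          using xi by (auto simp: simps y_def restrict_def fun_eq_iff in_factor)
        then show ?thesis ..
      next
        assume "c \<otimes>\<^bsub>S i\<^esub> x i = \<zero>\<^bsub>S i\<^esub>"
        then have "y \<otimes>\<^bsub>?P\<^esub> x = \<zero>\<^bsub>?P\<^esub>"
          using xi by (auto simp: simps y_def restrict_def fun_eq_iff in_factor)
        then show ?thesis ..
      qed
      ultimately show "x \<in> zero_divisors ?P" using x unfolding zero_divisors_def by blast
    qed
    fix y assume y: "y \<in> carrier ?P"
    then have yi: "y i \<in> carrier (S i)" if "i \<in> J" for i using that by (auto simp: simps)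
    show "x \<oplus>\<^bsub>?P\<^esub> y \<in> carrier ?P" using xi yi by (auto simp: simps add_mem)
    show "family_locus J S (x \<oplus>\<^bsub>?P\<^esub> y) = family_locus J S x \<inter> family_locus J S y"
      using xi yi by (auto simp: simps in_factor)
  qed
qed

lemma card_locus_class_product:
  assumes "finite J" and "A \<subseteq> J"
  shows "card (locus_class (product_semiring J S) (family_locus J S) A) =
    (\<Prod>i\<in>J. if i \<in> A then card (zero_divisors (S i)) else card (carrier (S i) - zero_divisors (S i)))"
proof -
  have "locus_class (product_semiring J S) (family_locus J S) A =
    (\<Pi>\<^sub>E i\<in>J. if i \<in> A then zero_divisors (S i) else carrier (S i) - zero_divisors (S i))"
  proof (intro equalityI subsetI)
    fix x assume "x \<in> locus_class (product_semiring J S) (family_locus J S) A"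
    then show "x \<in> (\<Pi>\<^sub>E i\<in>J. if i \<in> A then zero_divisors (S i) else carrier (S i) - zero_divisors (S i))"
      by (auto simp: locus_class_def product_semiring_def family_locus_def PiE_iff)
  next
    fix x assume x: "x \<in> (\<Pi>\<^sub>E i\<in>J. if i \<in> A then zero_divisors (S i) else carrier (S i) - zero_divisors (S i))"
    have "(x i \<in> zero_divisors (S i) \<longleftrightarrow> i \<in> A) \<and> x i \<in> carrier (S i)" if "i \<in> J" for i
      using PiE_mem[OF x that] zero_divisors_subset[of "S i"] by (auto split: if_splits)
    then show "x \<in> locus_class (product_semiring J S) (family_locus J S) A"
      using x assms(2) by (auto simp: locus_class_def product_semiring_def family_locus_def PiE_iff)
  qed
  then show ?thesis using assms(1) by (simp add: card_PiE if_distrib cong: if_cong)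
qed

definition pair_locus :: "('a \<Rightarrow> 'i set) \<Rightarrow> ('b \<Rightarrow> 'j set) \<Rightarrow> 'a \<times> 'b \<Rightarrow> ('i + 'j) set" where
  "pair_locus f g = (\<lambda>(x, y). f x <+> g y)"

lemma RDirProd_simps:
  "carrier (RDirProd A B) = carrier A \<times> carrier B"
  "\<zero>\<^bsub>RDirProd A B\<^esub> = (\<zero>\<^bsub>A\<^esub>, \<zero>\<^bsub>B\<^esub>)"
  "(a, b) \<oplus>\<^bsub>RDirProd A B\<^esub> (a', b') = (a \<oplus>\<^bsub>A\<^esub> a', b \<oplus>\<^bsub>B\<^esub> b')"
  "(a, b) \<otimes>\<^bsub>RDirProd A B\<^esub> (a', b') = (a \<otimes>\<^bsub>A\<^esub> a', b \<otimes>\<^bsub>B\<^esub> b')"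
  by (simp_all add: RDirProd_def DirProd_def monoid.defs)

lemma Plus_Int: "(A <+> B) \<inter> (C <+> D) = (A \<inter> C) <+> (B \<inter> D)"
  by auto

lemma zd_locus_RDirProd:
  assumes "zd_locus A I f" and "zd_locus B J g"
  shows "zd_locus (RDirProd A B) (I <+> J) (pair_locus f g)"
proof -
  interpret A: zd_locus A I f by fact
  interpret B: zd_locus B J g by fact
  let ?P = "RDirProd A B"
  have zd: "(a, b) \<in> zero_divisors ?P \<longleftrightarrow> a \<in> zero_divisors A \<or> b \<in> zero_divisors B"
    if ab: "a \<in> carrier A" "b \<in> carrier B" for a b
  proof
    assume "(a, b) \<in> zero_divisors ?P"
    then show "a \<in> zero_divisors A \<or> b \<in> zero_divisors B"
      using ab by (auto simp: zero_divisors_def RDirProd_simps)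
  next
    assume "a \<in> zero_divisors A \<or> b \<in> zero_divisors B"
    then show "(a, b) \<in> zero_divisors ?P"
    proof
      assume "a \<in> zero_divisors A"
      then obtain c where "c \<in> carrier A" "c \<noteq> \<zero>\<^bsub>A\<^esub>" "a \<otimes>\<^bsub>A\<^esub> c = \<zero>\<^bsub>A\<^esub> \<or> c \<otimes>\<^bsub>A\<^esub> a = \<zero>\<^bsub>A\<^esub>"
        by (auto simp: zero_divisors_def)
      then have "(c, \<zero>\<^bsub>B\<^esub>) \<in> carrier ?P" "(c, \<zero>\<^bsub>B\<^esub>) \<noteq> \<zero>\<^bsub>?P\<^esub>"
        "(a, b) \<otimes>\<^bsub>?P\<^esub> (c, \<zero>\<^bsub>B\<^esub>) = \<zero>\<^bsub>?P\<^esub> \<or> (c, \<zero>\<^bsub>B\<^esub>) \<otimes>\<^bsub>?P\<^esub> (a, b) = \<zero>\<^bsub>?P\<^esub>"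
        using ab B.zero_closed by (auto simp: RDirProd_simps B.l_null B.r_null)
      moreover have "(a, b) \<in> carrier ?P" using ab by (simp add: RDirProd_simps)
      ultimately show ?thesis unfolding zero_divisors_def by blast
    next
      assume "b \<in> zero_divisors B"
      then obtain c where "c \<in> carrier B" "c \<noteq> \<zero>\<^bsub>B\<^esub>" "b \<otimes>\<^bsub>B\<^esub> c = \<zero>\<^bsub>B\<^esub> \<or> c \<otimes>\<^bsub>B\<^esub> b = \<zero>\<^bsub>B\<^esub>"
        by (auto simp: zero_divisors_def)
      then have "(\<zero>\<^bsub>A\<^esub>, c) \<in> carrier ?P" "(\<zero>\<^bsub>A\<^esub>, c) \<noteq> \<zero>\<^bsub>?P\<^esub>"
        "(a, b) \<otimes>\<^bsub>?P\<^esub> (\<zero>\<^bsub>A\<^esub>, c) = \<zero>\<^bsub>?P\<^esub> \<or> (\<zero>\<^bsub>A\<^esub>, c) \<otimes>\<^bsub>?P\<^esub> (a, b) = \<zero>\<^bsub>?P\<^esub>"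
        using ab A.zero_closed by (auto simp: RDirProd_simps A.l_null A.r_null)
      moreover have "(a, b) \<in> carrier ?P" using ab by (simp add: RDirProd_simps)
      ultimately show ?thesis unfolding zero_divisors_def by blast
    qed
  qed
  show ?thesis
  proof
    show "\<zero>\<^bsub>?P\<^esub> \<in> carrier ?P"
      by (simp add: RDirProd_simps A.zero_closed B.zero_closed)
    fix x assume "x \<in> carrier ?P"
    then obtain a b where x: "x = (a, b)" "a \<in> carrier A" "b \<in> carrier B"
      by (auto simp: RDirProd_simps)
    show "\<zero>\<^bsub>?P\<^esub> \<otimes>\<^bsub>?P\<^esub> x = \<zero>\<^bsub>?P\<^esub>" "x \<otimes>\<^bsub>?P\<^esub> \<zero>\<^bsub>?P\<^esub> = \<zero>\<^bsub>?P\<^esub>"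
      using x by (simp_all add: RDirProd_simps A.l_null B.l_null A.r_null B.r_null)
    show "pair_locus f g x \<subseteq> I <+> J"
      using x A.locus_subset B.locus_subset by (auto simp: pair_locus_def)
    show "x \<in> zero_divisors ?P \<longleftrightarrow> pair_locus f g x \<noteq> {}"
      using x zd A.zero_divisor_iff B.zero_divisor_iff by (simp add: pair_locus_def)
    fix y assume "y \<in> carrier ?P"
    then obtain c d where y: "y = (c, d)" "c \<in> carrier A" "d \<in> carrier B"
      by (auto simp: RDirProd_simps)
    show "x \<oplus>\<^bsub>?P\<^esub> y \<in> carrier ?P"
      using x y by (simp add: RDirProd_simps A.add_closed B.add_closed)
    show "pair_locus f g (x \<oplus>\<^bsub>?P\<^esub> y) = pair_locus f g x \<inter> pair_locus f g y"
      using x y by (simp add: RDirProd_simps pair_locus_def A.locus_add B.locus_add Plus_Int)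
  qed
qed

lemma card_locus_class_RDirProd:
  "card (locus_class (RDirProd A B) (pair_locus f g) C) =
     card (locus_class A f (Inl -` C)) * card (locus_class B g (Inr -` C))"
proof -
  have eq: "X <+> Y = C \<longleftrightarrow> X = Inl -` C \<and> Y = Inr -` C" for X Y
    unfolding set_eq_iff by (auto simp: split_sum_all)
  have pair_eq: "pair_locus f g (a, b) = C \<longleftrightarrow> f a = Inl -` C \<and> g b = Inr -` C" for a b
    by (simp add: pair_locus_def eq)
  have "locus_class (RDirProd A B) (pair_locus f g) C =
      locus_class A f (Inl -` C) \<times> locus_class B g (Inr -` C)"
  proof (rule Set.set_eqI)
    show "p \<in> locus_class (RDirProd A B) (pair_locus f g) C \<longleftrightarrow>
        p \<in> locus_class A f (Inl -` C) \<times> locus_class B g (Inr -` C)" for p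
      by (cases p) (simp add: locus_class_def RDirProd_simps pair_eq conj_ac)
  qed
  then show ?thesis by (simp add: card_cartesian_product)
qed

text \<open>
  Applies to the Boolean factors and to the \<open>Z\<^sub>i\<close> alike: in both, \<open>1\<close> is the only non-zero-divisor.
\<close>

lemma card_locus_class_unit_product:
  assumes "finite J" and "A \<subseteq> J"
    and "\<And>i. i \<in> J \<Longrightarrow> card (carrier (S i) - zero_divisors (S i)) = 1"
  shows "card (locus_class (product_semiring J S) (family_locus J S) A) =
    (\<Prod>i\<in>A. card (zero_divisors (S i)))"
proof -
  have "(\<Prod>i\<in>J. if i \<in> A then card (zero_divisors (S i))
        else card (carrier (S i) - zero_divisors (S i))) =
      (\<Prod>i\<in>J. if i \<in> A then card (zero_divisors (S i)) else 1)"
    using assms(3) by (intro prod.cong) auto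
  also have "\<dots> = (\<Prod>i\<in>J \<inter> A. card (zero_divisors (S i)))"
    using assms(1) by (simp add: prod.inter_restrict)
  finally show ?thesis
    using assms(1,2) by (simp add: card_locus_class_product Int_absorb1)
qed


section \<open>The two families of products\<close>

lemma finite_RDirProd: "finite (carrier A) \<Longrightarrow> finite (carrier B) \<Longrightarrow> finite (carrier (RDirProd A B))"
  by (simp add: RDirProd_simps)

lemma finite_product_semiring:
  "finite J \<Longrightarrow> (\<And>i. i \<in> J \<Longrightarrow> finite (carrier (S i))) \<Longrightarrow> finite (carrier (product_semiring J S))"
  by (simp add: product_semiring_def finite_PiE)

text \<open>
  The first shape of product. The lone loci are exactly the nonempty subsets of \<open>P\<close>, so a largest
  omittable family lacks \<open>card P\<close> of the nonempty sets of coordinates.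
\<close>

lemma metric_dim_singleton_classes:
  fixes A :: "('a, 'c) ring_scheme" and B :: "('b, 'd) ring_scheme"
    and P :: "'i set" and N :: "'j set"
  assumes A: "zd_locus A P f" "finite P" "finite (carrier A)"
      "\<And>X. X \<subseteq> P \<Longrightarrow> card (locus_class A f X) = 1"
    and B: "zd_locus B N g" "finite N" "finite (carrier B)" "N \<noteq> {}"
      "\<And>X. X \<subseteq> N \<Longrightarrow> card (locus_class B g X) > 0"
      "\<And>X. X \<subseteq> N \<Longrightarrow> card (locus_class B g X) = 1 \<longleftrightarrow> X = {}"
  defines "S \<equiv> RDirProd A B"
  shows "card (zero_divisors S) + card P + 1 = metric_dim (Gamma1 S) + 2 ^ (card P + card N)"
    and "card (carrier S) = card (zero_divisors S) + 1"
proof -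
  let ?I = "P <+> N"
  let ?locus = "pair_locus f g"
  define Q where "Q = {C. card (locus_class S ?locus C) = 1}"
  have S: "zd_locus S ?I ?locus" "finite (carrier S)"
    using A(1,3) B(1,3) by (simp_all add: S_def zd_locus_RDirProd finite_RDirProd)
  have class_card: "card (locus_class S ?locus C) = card (locus_class B g (Inr -` C))"
    if "C \<subseteq> ?I" for C
  proof -
    have "Inl -` C \<subseteq> P" using that by auto
    then show ?thesis using A(4) by (simp add: S_def card_locus_class_RDirProd)
  qed
  have sub_N: "Inr -` C \<subseteq> N" if "C \<subseteq> ?I" for C using that by auto
  have inhabited: "locus_class S ?locus C \<noteq> {}" if "C \<subseteq> ?I" for C
    using class_card[OF that] B(5)[OF sub_N[OF that]] by auto
  have Q_iff: "C \<in> Q \<longleftrightarrow> Inr -` C = {}" if "C \<subseteq> ?I" for C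
    using class_card[OF that] B(6)[OF sub_N[OF that]] by (simp add: Q_def)
  have fin: "finite ?I" using A(2) B(2) by simp
  have card_I: "card ?I = card P + card N" using A(2) B(2) by (simp add: card_Plus)
  have card_P: "card (Inl ` P :: ('i + 'j) set) = card P" by (simp add: card_image)
  define \<U> where "\<U> = nonempty_subsets ?I - (\<lambda>i. {i}) ` Inl ` P"
  have rare: "{i} \<notin> Q" if "i \<in> ?I - Inl ` P" for i
  proof -
    obtain j where "i = Inr j" "{i} \<subseteq> ?I" using \<open>i \<in> ?I - Inl ` P\<close> by auto
    then show ?thesis using Q_iff[of "{i}"] by auto
  qed
  have \<U>: "omittable ?I Q \<U>" "card \<U> + card P = 2 ^ (card P + card N) - 1"
    using omittable_without_rare_singletons[OF fin _ rare, of "Inl ` P"]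
    by (auto simp: \<U>_def card_I card_P)
  have "card \<V> \<le> card \<U>" if "omittable ?I Q \<V>" for \<V>
  proof -
    have "nonempty_subsets (Inl ` P) \<subseteq> Q"
    proof
      fix C assume "C \<in> nonempty_subsets (Inl ` P :: ('i + 'j) set)"
      then have "C \<subseteq> Inl ` P" by (simp add: nonempty_subsets_def)
      then have "C \<subseteq> ?I" "Inr -` C = {}" by auto
      then show "C \<in> Q" using Q_iff by simp
    qed
    then have "card \<V> + card (Inl ` P :: ('i + 'j) set) \<le> 2 ^ card ?I - 1"
      using B(4) that by (intro card_omittable_le[OF fin, where N = "Inr ` N"]) (auto simp: Plus_def)
    then show ?thesis using \<U>(2) by (simp add: card_I card_P)
  qed
  then have "card (zero_divisors S) = metric_dim (Gamma1 S) + card \<U>"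
    using S inhabited \<U>(1) unfolding Q_def by (intro metric_dim_Gamma1)
  moreover have "(2 :: nat) ^ (card P + card N) \<ge> 1" by simp
  ultimately show "card (zero_divisors S) + card P + 1 = metric_dim (Gamma1 S) + 2 ^ (card P + card N)"
    using \<U>(2) by linarith
  have "card (locus_class S ?locus {}) = 1"
    using class_card[of "{}"] B(6)[of "{}"] by simp
  then show "card (carrier S) = card (zero_divisors S) + 1"
    using card_carrier_eq[OF S] by simp
qed

text \<open>
  The second shape of product. A locus avoiding the coordinate of \<open>R\<close> is never lone, because \<open>R\<close> has at
  least two non-zero-divisors; hence the coordinate of \<open>R\<close> is the only one whose singleton is lone.
\<close>

lemma metric_dim_one_zero_divisor_factor:
  fixes R :: "('a, 'c) ring_scheme" and B :: "('b, 'd) ring_scheme" and N :: "'j set"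
  assumes R: "additive_zd_semiring R" "finite (carrier R)" "card (zero_divisors R) = 1"
      "card (carrier R) \<ge> 3"
    and B: "zd_locus B N g" "finite N" "finite (carrier B)" "N \<noteq> {}"
      "\<And>X. X \<subseteq> N \<Longrightarrow> card (locus_class B g X) > 0"
      "card (locus_class B g {}) = 1"
  defines "S \<equiv> RDirProd R B"
  shows "card (zero_divisors S) + 2 = metric_dim (Gamma1 S) + 2 ^ (card N + 1)"
    and "card (carrier S) + 1 = card (zero_divisors S) + card (carrier R)"
proof -
  let ?I = "{()} <+> N"
  let ?locus = "pair_locus (factor_locus R) g"
  define Q where "Q = {C. card (locus_class S ?locus C) = 1}"
  have S: "zd_locus S ?I ?locus" "finite (carrier S)"
    using R(1,2) B(1,3) by (simp_all add: S_def zd_locus_RDirProd zd_locus_factor finite_RDirProd)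
  have "card (carrier R - zero_divisors R) = card (carrier R) - 1"
    using R zero_divisors_subset[of R] by (simp add: card_Diff_subset finite_subset)
  then have classes_R: "card (locus_class R (factor_locus R) {()}) = 1"
      "card (locus_class R (factor_locus R) {}) = card (carrier R) - 1"
    using R(3) by (simp_all add: locus_class_factor)
  have class_card: "card (locus_class S ?locus C) =
      (if Inl () \<in> C then 1 else card (carrier R) - 1) * card (locus_class B g (Inr -` C))" for C
  proof -
    have "Inl -` C = (if Inl () \<in> C then {()} else {})" by auto
    then show ?thesis by (simp add: S_def card_locus_class_RDirProd classes_R)
  qed
  have inhabited: "locus_class S ?locus C \<noteq> {}" if "C \<subseteq> ?I" for C
  proof -
    have "Inr -` C \<subseteq> N" using that by auto
    then have "card (locus_class S ?locus C) \<noteq> 0" using class_card B(5) R(4) by auto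
    then show ?thesis by auto
  qed
  have fin: "finite ?I" using B(2) by simp
  have card_I: "card ?I = card N + 1" using B(2) by (simp add: card_Plus)
  have lone: "{Inl ()} \<in> Q"
  proof -
    have "Inr -` {Inl ()} = ({} :: 'j set)" by auto
    then show ?thesis using class_card[of "{Inl ()}"] B(6) by (simp add: Q_def)
  qed
  define \<U> where "\<U> = nonempty_subsets ?I - (\<lambda>i. {i}) ` {Inl ()}"
  have common: "{i} \<notin> Q" if "i \<in> ?I - {Inl ()}" for i
    using that class_card[of "{i}"] R(4) by (auto simp: Q_def)
  have \<U>: "omittable ?I Q \<U>" "card \<U> + 1 = 2 ^ (card N + 1) - 1"
    using omittable_without_rare_singletons[OF fin _ common, of "{Inl ()}"]
    by (auto simp: \<U>_def card_I)
  have "card \<V> \<le> card \<U>" if "omittable ?I Q \<V>" for \<V>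
  proof -
    have "?I \<noteq> {Inl ()}" using B(4) by auto
    then have "card \<V> + 1 \<le> 2 ^ card ?I - 1"
      using lone that by (intro card_omittable_less[OF fin, where r = "Inl ()"]) auto
    then show ?thesis using \<U>(2) by (simp add: card_I)
  qed
  then have "card (zero_divisors S) = metric_dim (Gamma1 S) + card \<U>"
    using S inhabited \<U>(1) unfolding Q_def by (intro metric_dim_Gamma1)
  moreover have "(2 :: nat) ^ (card N + 1) \<ge> 1" by simp
  ultimately show "card (zero_divisors S) + 2 = metric_dim (Gamma1 S) + 2 ^ (card N + 1)"
    using \<U>(2) by linarith
  have "card (locus_class S ?locus {}) = card (carrier R) - 1"
    using class_card[of "{}"] B(6) by simp
  then show "card (carrier S) + 1 = card (zero_divisors S) + card (carrier R)"
    using card_carrier_eq[OF S] R(4) by simp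
qed

theorem theorem3p6:
  fixes m n :: nat
    and Z :: "nat \<Rightarrow> ('z, 'y) ring_scheme"
    and R :: "('r, 'q) ring_scheme"
  assumes Z: "\<And>i. i \<in> {1..n} \<Longrightarrow>
      comm_semiring (Z i) \<and> finite (carrier (Z i)) \<and> antinegative (Z i) \<and>
      (\<forall>x\<in>zero_divisors (Z i). \<forall>y\<in>zero_divisors (Z i). x \<oplus>\<^bsub>Z i\<^esub> y \<in> zero_divisors (Z i)) \<and>
      card (carrier (Z i)) \<ge> 3 \<and> card (carrier (Z i) - zero_divisors (Z i)) = 1"
  shows
    "(m \<ge> 1 \<and> n \<ge> 1 \<longrightarrow>
       (let S = RDirProd (product_semiring {1..m} (\<lambda>_. boolean_semiring))
                         (product_semiring {1..n} Z)
        in int (metric_dim (Gamma1 S)) = int (card (carrier S)) + int m - 2 ^ (m + n) \<and>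
           int (card (carrier S)) + int m - 2 ^ (m + n)
             = int (card (zero_divisors S)) - 2 ^ (m + n) + int m + 1))
     \<and>
     (\<not> (m = 0 \<and> n = 0) \<and>
      comm_semiring R \<and> finite (carrier R) \<and> antinegative R \<and>
      card (carrier R) \<ge> 3 \<and> card (zero_divisors R) = 1 \<longrightarrow>
       (let S = RDirProd R (RDirProd (product_semiring {1..m} (\<lambda>_. boolean_semiring))
                                     (product_semiring {1..n} Z))
        in int (metric_dim (Gamma1 S))
             = int (card (carrier S)) - 2 ^ (m + n + 1) - int (card (carrier R)) + 3 \<and>
           int (card (carrier S)) - 2 ^ (m + n + 1) - int (card (carrier R)) + 3
             = int (card (zero_divisors S)) - 2 ^ (m + n + 1) + 2))"
proof -
  let ?B = "product_semiring {1..m} (\<lambda>_. boolean_semiring)"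
  let ?f = "family_locus {1..m} (\<lambda>_. boolean_semiring)"
  let ?Z = "product_semiring {1..n} Z"
  let ?g = "family_locus {1..n} Z"
  have Z_factor: "additive_zd_semiring (Z i)" if "i \<in> {1..n}" for i
  proof (rule additive_zd_semiringI)
    show "semiring (Z i)" using Z[OF that] by (simp add: comm_semiring_def)
  qed (use Z[OF that] in blast)+
  have Z_card: "card (zero_divisors (Z i)) \<ge> 2" if "i \<in> {1..n}" for i
  proof -
    have "card (carrier (Z i) - zero_divisors (Z i)) = card (carrier (Z i)) - card (zero_divisors (Z i))"
      using Z[OF that] zero_divisors_subset[of "Z i"] by (intro card_Diff_subset) (auto intro: finite_subset)
    then show ?thesis using Z[OF that] by linarith
  qed
  have B: "zd_locus ?B {1..m} ?f" "finite (carrier ?B)"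
    by (auto intro!: zd_locus_product additive_zd_boolean finite_product_semiring
        simp: carrier_boolean)
  have B_class: "card (locus_class ?B ?f X) = 1" if "X \<subseteq> {1..m}" for X
  proof -
    have "card (carrier boolean_semiring - zero_divisors boolean_semiring) = 1"
      by (simp add: carrier_boolean zero_divisors_boolean)
    then show ?thesis
      using that by (simp add: card_locus_class_unit_product zero_divisors_boolean)
  qed
  have ZZ: "zd_locus ?Z {1..n} ?g" "finite (carrier ?Z)"
    using Z by (auto intro!: zd_locus_product Z_factor finite_product_semiring)
  have Z_class: "card (locus_class ?Z ?g X) = (\<Prod>i\<in>X. card (zero_divisors (Z i)))"
    if "X \<subseteq> {1..n}" for X
    using that Z by (intro card_locus_class_unit_product) auto
  have Z_class_pos: "card (locus_class ?Z ?g X) > 0" if X: "X \<subseteq> {1..n}" for X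
    unfolding Z_class[OF X] using Z_card X by (intro prod_pos) fastforce
  have Z_class_1: "card (locus_class ?Z ?g X) = 1 \<longleftrightarrow> X = {}" if X: "X \<subseteq> {1..n}" for X
  proof -
    have "finite X" using X finite_subset by blast
    moreover have "card (zero_divisors (Z i)) \<noteq> 1" if "i \<in> X" for i
      using Z_card[of i] X that by auto
    ultimately show ?thesis unfolding Z_class[OF X]
      using prod_eq_1_iff[of X "\<lambda>i. card (zero_divisors (Z i))"] by blast
  qed
  show ?thesis
  proof (intro conjI impI)
    assume mn: "m \<ge> 1 \<and> n \<ge> 1"
    let ?S = "RDirProd ?B ?Z"
    have dim: "card (zero_divisors ?S) + m + 1 = metric_dim (Gamma1 ?S) + 2 ^ (m + n)"
      "card (carrier ?S) = card (zero_divisors ?S) + 1"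
      using metric_dim_singleton_classes[OF B(1) _ B(2) B_class ZZ(1) _ ZZ(2) _ Z_class_pos Z_class_1] mn
      by simp_all
    have "int (card (zero_divisors ?S)) + int m + 1 = int (metric_dim (Gamma1 ?S)) + 2 ^ (m + n)"
      "int (card (carrier ?S)) = int (card (zero_divisors ?S)) + 1"
      using arg_cong[OF dim(1), of int] arg_cong[OF dim(2), of int] by simp_all
    then show "let S = ?S
        in int (metric_dim (Gamma1 S)) = int (card (carrier S)) + int m - 2 ^ (m + n) \<and>
           int (card (carrier S)) + int m - 2 ^ (m + n)
             = int (card (zero_divisors S)) - 2 ^ (m + n) + int m + 1"
      unfolding Let_def by linarith
  next
    assume R: "\<not> (m = 0 \<and> n = 0) \<and> comm_semiring R \<and> finite (carrier R) \<and> antinegative R \<and>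
      card (carrier R) \<ge> 3 \<and> card (zero_divisors R) = 1"
    let ?T = "RDirProd ?B ?Z"
    let ?S = "RDirProd R ?T"
    let ?N = "{1..m} <+> {1..n}"
    let ?h = "pair_locus ?f ?g"
    interpret R: semiring R using R by (simp add: comm_semiring_def)
    have "carrier R \<noteq> {\<zero>\<^bsub>R\<^esub>}" using R by auto
    then have "zero_divisors R = {\<zero>\<^bsub>R\<^esub>}"
      using R R.zero_is_zero_divisor by (metis card_1_singletonE singletonD)
    then have R_factor: "additive_zd_semiring R"
      using R R.semiring_axioms by (intro additive_zd_semiringI) auto
    have T: "zd_locus ?T ?N ?h" "finite (carrier ?T)"
      using B ZZ by (simp_all add: zd_locus_RDirProd finite_RDirProd)
    have T_class: "card (locus_class ?T ?h X) = card (locus_class ?Z ?g (Inr -` X))"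
      if "X \<subseteq> ?N" for X
    proof -
      have "Inl -` X \<subseteq> {1..m}" using that by auto
      then show ?thesis using B_class by (simp add: card_locus_class_RDirProd)
    qed
    have T_class_pos: "card (locus_class ?T ?h X) > 0" if X: "X \<subseteq> ?N" for X
    proof -
      have "Inr -` X \<subseteq> {1..n}" using X by auto
      then show ?thesis using Z_class_pos T_class[OF X] by simp
    qed
    have "card (locus_class ?T ?h {}) = 1" using T_class[of "{}"] Z_class_1[of "{}"] by simp
    moreover have "?N \<noteq> {}" "finite ?N" "card ?N = m + n" using R by (auto simp: card_Plus)
    ultimately have dim: "card (zero_divisors ?S) + 2 = metric_dim (Gamma1 ?S) + 2 ^ (m + n + 1)"
      "card (carrier ?S) + 1 = card (zero_divisors ?S) + card (carrier R)"
      using metric_dim_one_zero_divisor_factor[OF R_factor _ _ _ T(1) _ T(2) _ T_class_pos] R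
      by simp_all
    have "int (card (zero_divisors ?S)) + 2 = int (metric_dim (Gamma1 ?S)) + 2 ^ (m + n + 1)"
      "int (card (carrier ?S)) + 1 = int (card (zero_divisors ?S)) + int (card (carrier R))"
      using arg_cong[OF dim(1), of int] arg_cong[OF dim(2), of int] by simp_all
    then show "let S = ?S
        in int (metric_dim (Gamma1 S))
             = int (card (carrier S)) - 2 ^ (m + n + 1) - int (card (carrier R)) + 3 \<and>
           int (card (carrier S)) - 2 ^ (m + n + 1) - int (card (carrier R)) + 3
             = int (card (zero_divisors S)) - 2 ^ (m + n + 1) + 2"
      unfolding Let_def by linarith
  qed
qed

end
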